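(* For each $n\in\{0,8,16,24,40\}$, there exist a short exact sequence of groups $1\to Q_8 \to G' \stackrel{q}{\to} G\to 1$ and commuting elements $\alpha,\beta$ of $G$ such that $|L(\alpha,\beta,q)|=n$, where $$L(\alpha,\beta,q)=\{(a,b)\in G'\times G' \mid q(a)=\alpha,\ q(b)=\beta,\ ab=ba\}.$$
   Context: $Q_8=\{\pm1,\pm i,\pm j,\pm k\}$ is the quaternion group of order $8$. *)

theory Defs
  imports "HOL-Algebra.Algebra" "HOL-Algebra.Exact_Sequence"
begin

text \<open>
  The quaternion group. A pair \<open>(s, u)\<close> stands for \<open>u\<close> if \<open>s\<close> is \<open>False\<close>
  and for \<open>- u\<close> if \<open>s\<close> is \<open>True\<close>.
\<close>

datatype quat_unit = U1 | UI | UJ | UK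

fun quat_unit_mult :: "quat_unit \<Rightarrow> quat_unit \<Rightarrow> bool \<times> quat_unit" where
  "quat_unit_mult U1 u = (False, u)"
| "quat_unit_mult u U1 = (False, u)"
| "quat_unit_mult UI UI = (True, U1)"
| "quat_unit_mult UJ UJ = (True, U1)"
| "quat_unit_mult UK UK = (True, U1)"
| "quat_unit_mult UI UJ = (False, UK)"
| "quat_unit_mult UJ UK = (False, UI)"
| "quat_unit_mult UK UI = (False, UJ)"
| "quat_unit_mult UJ UI = (True, UK)"
| "quat_unit_mult UK UJ = (True, UI)"
| "quat_unit_mult UI UK = (True, UJ)"

fun quat_mult :: "bool \<times> quat_unit \<Rightarrow> bool \<times> quat_unit \<Rightarrow> bool \<times> quat_unit" where
  "quat_mult (s, u) (t, v) = (let (r, w) = quat_unit_mult u v in ((s \<noteq> t) \<noteq> r, w))"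

definition Q8 :: "(bool \<times> quat_unit) monoid" where
  "Q8 = \<lparr>carrier = UNIV, monoid.mult = quat_mult, one = (False, U1)\<rparr>"

lemma UNIV_quat_unit: "UNIV = {U1, UI, UJ, UK}"
  using quat_unit.exhaust by blast

lemma group_Q8: "group Q8"
proof (rule groupI)
  fix x y z
  show "x \<otimes>\<^bsub>Q8\<^esub> y \<otimes>\<^bsub>Q8\<^esub> z = x \<otimes>\<^bsub>Q8\<^esub> (y \<otimes>\<^bsub>Q8\<^esub> z)"
    by (cases x; cases y; cases z; cases "snd x"; cases "snd y"; cases "snd z")
       (auto simp: Q8_def)
next
  fix x
  have "quat_mult (case x of (s, u) \<Rightarrow> (s \<noteq> (u \<noteq> U1), u)) x = (False, U1)"
    by (cases x; cases "snd x") auto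
  then show "\<exists>y\<in>carrier Q8. y \<otimes>\<^bsub>Q8\<^esub> x = \<one>\<^bsub>Q8\<^esub>"
    unfolding Q8_def by (simp del: split_paired_Ex) blast
qed (auto simp: Q8_def)

lemma order_Q8: "order Q8 = 8"
  unfolding order_def Q8_def
  by (simp add: UNIV_Times_UNIV[symmetric] UNIV_quat_unit UNIV_bool card_cartesian_product
           del: UNIV_Times_UNIV)

text \<open>
  The library's \<^const>\<open>short_exact_sequence\<close> requires the three groups to live on the
  same type; the following version of \<open>1 \<rightarrow> N \<rightarrow> G' \<rightarrow> G \<rightarrow> 1\<close> does not.
\<close>

definition short_exact ::
    "'a monoid \<Rightarrow> ('a \<Rightarrow> 'b) \<Rightarrow> 'b monoid \<Rightarrow> ('b \<Rightarrow> 'c) \<Rightarrow> 'c monoid \<Rightarrow> bool" where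
  "short_exact N \<iota> G' q G \<longleftrightarrow>
     group N \<and> group G' \<and> group G \<and>
     \<iota> \<in> mon N G' \<and> q \<in> epi G' G \<and> \<iota> ` carrier N = kernel G' G q"

lemma short_exact_iff_short_exact_sequence:
  "short_exact N \<iota> G' q G \<longleftrightarrow> short_exact_sequence G G' N q \<iota>"
  unfolding short_exact_def short_exact_sequence_iff
  by (auto simp: group_hom_def group_hom_axioms_def mon_def epi_def)

definition commuting_lifts ::
    "'b monoid \<Rightarrow> 'c \<Rightarrow> 'c \<Rightarrow> ('b \<Rightarrow> 'c) \<Rightarrow> ('b \<times> 'b) set" where
  "commuting_lifts G' \<alpha> \<beta> q =
     {(a, b) \<in> carrier G' \<times> carrier G'. q a = \<alpha> \<and> q b = \<beta> \<and> a \<otimes>\<^bsub>G'\<^esub> b = b \<otimes>\<^bsub>G'\<^esub> a}"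

end

theory Submission
  imports Defs "HOL-Library.Countable"
begin

text \<open>
  Take \<open>Q\<^sub>8 \<times> \<langle>b\<rangle>\<close> with \<open>\<langle>b\<rangle> \<cong> \<int>\<close>, and let \<open>a\<close> act on it by an automorphism \<open>\<phi>\<close> of
  \<open>Q\<^sub>8\<close> and by \<open>a b a\<^sup>-\<^sup>1 = - b\<close>. The semidirect product with \<open>\<langle>a\<rangle> \<cong> \<int>\<close> is an extension of \<open>\<int>\<^sup>2\<close> by
  \<open>Q\<^sub>8\<close>. The lifts \<open>x a\<close> and \<open>y\<close> of the images of \<open>a\<close> and \<open>1\<close> commute iff \<open>x \<phi>(y) = y x\<close>, and the
  lifts \<open>x a\<close> and \<open>y b\<close> of the images of \<open>a\<close> and \<open>b\<close> commute iff \<open>- x \<phi>(y) = y x\<close>. If \<open>\<phi>\<close> represents an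
  element of order 2 in \<open>Out(Q\<^sub>8) \<cong> S\<^sub>3\<close>, these equations have 24 and 8 solutions; if it represents
  one of order 3, they have 16 and 0 solutions. Finally \<open>x y = y x\<close> has 40 solutions.
\<close>

section \<open>Semidirect products\<close>

definition semidirect :: "'a monoid \<Rightarrow> 'b monoid \<Rightarrow> ('b \<Rightarrow> 'a \<Rightarrow> 'a) \<Rightarrow> ('a \<times> 'b) monoid" where
  "semidirect N H \<sigma> =
     \<lparr>carrier = carrier N \<times> carrier H,
      monoid.mult = (\<lambda>(x, h) (y, k). (x \<otimes>\<^bsub>N\<^esub> \<sigma> h y, h \<otimes>\<^bsub>H\<^esub> k)),
      one = (\<one>\<^bsub>N\<^esub>, \<one>\<^bsub>H\<^esub>)\<rparr>"

lemma carrier_semidirect [simp]: "carrier (semidirect N H \<sigma>) = carrier N \<times> carrier H"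
  and mult_semidirect [simp]:
    "(x, h) \<otimes>\<^bsub>semidirect N H \<sigma>\<^esub> (y, k) = (x \<otimes>\<^bsub>N\<^esub> \<sigma> h y, h \<otimes>\<^bsub>H\<^esub> k)"
  and one_semidirect [simp]: "\<one>\<^bsub>semidirect N H \<sigma>\<^esub> = (\<one>\<^bsub>N\<^esub>, \<one>\<^bsub>H\<^esub>)"
  by (simp_all add: semidirect_def)

lemma AutoGroup_simps:
  shows carrier_AutoGroup: "carrier (AutoGroup N) = auto N"
    and one_AutoGroup: "\<one>\<^bsub>AutoGroup N\<^esub> = (\<lambda>x\<in>carrier N. x)"
    and mult_AutoGroup: "f \<in> auto N \<Longrightarrow> g \<in> auto N \<Longrightarrow> f \<otimes>\<^bsub>AutoGroup N\<^esub> g = compose (carrier N) f g"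
  by (simp_all add: AutoGroup_def BijGroup_def auto_def)

lemma auto_closed: "f \<in> auto N \<Longrightarrow> x \<in> carrier N \<Longrightarrow> f x \<in> carrier N"
  and auto_mult: "f \<in> auto N \<Longrightarrow> x \<in> carrier N \<Longrightarrow> y \<in> carrier N \<Longrightarrow>
    f (x \<otimes>\<^bsub>N\<^esub> y) = f x \<otimes>\<^bsub>N\<^esub> f y"
  by (auto simp: auto_def hom_def)

lemma hom_AutoGroup_simps:
  assumes "group N" "group H" "\<sigma> \<in> hom H (AutoGroup N)"
  shows "h \<in> carrier H \<Longrightarrow> \<sigma> h \<in> auto N"
    and "x \<in> carrier N \<Longrightarrow> \<sigma> \<one>\<^bsub>H\<^esub> x = x"
    and "h \<in> carrier H \<Longrightarrow> k \<in> carrier H \<Longrightarrow> x \<in> carrier N \<Longrightarrow> \<sigma> (h \<otimes>\<^bsub>H\<^esub> k) x = \<sigma> h (\<sigma> k x)"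
proof -
  show auto: "h \<in> carrier H \<Longrightarrow> \<sigma> h \<in> auto N" for h
    using assms(3) by (auto simp: hom_def carrier_AutoGroup)
  show "x \<in> carrier N \<Longrightarrow> \<sigma> \<one>\<^bsub>H\<^esub> x = x"
    using hom_one[OF assms(3,2) group.AutoGroup[OF assms(1)]] by (simp add: one_AutoGroup)
  show "h \<in> carrier H \<Longrightarrow> k \<in> carrier H \<Longrightarrow> x \<in> carrier N \<Longrightarrow> \<sigma> (h \<otimes>\<^bsub>H\<^esub> k) x = \<sigma> h (\<sigma> k x)"
    using hom_mult[OF assms(3)] auto by (simp add: mult_AutoGroup compose_eq)
qed

lemma group_semidirect:
  assumes "group N" "group H" "\<sigma> \<in> hom H (AutoGroup N)"
  shows "group (semidirect N H \<sigma>)"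
proof -
  interpret N: group N by fact
  interpret H: group H by fact
  note \<sigma> [simp] = hom_AutoGroup_simps[OF assms]
  have closed [simp]: "\<sigma> h x \<in> carrier N" if "h \<in> carrier H" "x \<in> carrier N" for h x
    using that by (simp add: auto_closed)
  have one [simp]: "\<sigma> h \<one>\<^bsub>N\<^esub> = \<one>\<^bsub>N\<^esub>" if "h \<in> carrier H" for h
    using \<sigma>(1)[OF that] by (simp add: auto_def hom_one N.is_group)
  show ?thesis
  proof (rule groupI)
    fix u assume "u \<in> carrier (semidirect N H \<sigma>)"
    then obtain x h where u: "u = (x, h)" "x \<in> carrier N" "h \<in> carrier H" by auto
    \<comment> \<open>Reading \<open>(x, h)\<close> as the product x h, the inverse is h^-1 x^-1;
      moving h^-1 to the right applies \<open>\<sigma>\<close> of it to x^-1. A left inverse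
      suffices for \<open>groupI\<close>.\<close>
    let ?v = "(\<sigma> (inv\<^bsub>H\<^esub> h) (inv\<^bsub>N\<^esub> x), inv\<^bsub>H\<^esub> h)"
    have "?v \<otimes>\<^bsub>semidirect N H \<sigma>\<^esub> u = \<one>\<^bsub>semidirect N H \<sigma>\<^esub>"
      using u by (simp add: auto_mult[OF \<sigma>(1), symmetric])
    with u show "\<exists>v\<in>carrier (semidirect N H \<sigma>). v \<otimes>\<^bsub>semidirect N H \<sigma>\<^esub> u = \<one>\<^bsub>semidirect N H \<sigma>\<^esub>"
      by (intro bexI[of _ ?v]) simp_all
  qed (auto simp: auto_mult N.m_assoc H.m_assoc)
qed

text \<open>The last hypothesis says that H acts trivially on the quotient M of N. Dividing out K
  therefore turns the semidirect product into a direct one.\<close>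

lemma short_exact_semidirect:
  assumes ex: "short_exact K \<iota> N p M"
    and H: "group H"
    and \<sigma>: "\<sigma> \<in> hom H (AutoGroup N)"
    and inv: "\<And>h x. h \<in> carrier H \<Longrightarrow> x \<in> carrier N \<Longrightarrow> p (\<sigma> h x) = p x"
  shows "short_exact K (\<lambda>x. (\<iota> x, \<one>\<^bsub>H\<^esub>)) (semidirect N H \<sigma>) (map_prod p id) (M \<times>\<times> H)"
proof -
  from ex have gr: "group K" "group N" "group M"
    and \<iota>: "\<iota> \<in> mon K N" and p: "p \<in> epi N M" and ker: "\<iota> ` carrier K = kernel N M p"
    by (auto simp: short_exact_def)
  interpret H: group H by fact
  note act = hom_AutoGroup_simps[OF gr(2) H \<sigma>]
  have closed: "\<iota> x \<in> carrier N" if "x \<in> carrier K" for x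
    using that \<iota> by (auto simp: mon_def hom_def)
  have "(\<lambda>x. (\<iota> x, \<one>\<^bsub>H\<^esub>)) \<in> mon K (semidirect N H \<sigma>)"
    using \<iota> by (auto simp: mon_def hom_def inj_on_def act closed)
  moreover have "map_prod p id \<in> epi (semidirect N H \<sigma>) (M \<times>\<times> H)"
  proof -
    have "map_prod p id \<in> hom (semidirect N H \<sigma>) (M \<times>\<times> H)"
      using p by (auto simp: epi_def hom_def inv auto_closed[OF act(1)] Pi_iff)
    moreover have "map_prod p id ` (carrier N \<times> carrier H) = carrier M \<times> carrier H"
      using p by (simp add: epi_def map_prod_surj_on)
    ultimately show ?thesis by (simp add: epi_def)
  qed
  moreover have "(\<lambda>x. (\<iota> x, \<one>\<^bsub>H\<^esub>)) ` carrier K = (\<iota> ` carrier K) \<times> {\<one>\<^bsub>H\<^esub>}"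
    by auto
  then have "(\<lambda>x. (\<iota> x, \<one>\<^bsub>H\<^esub>)) ` carrier K
      = kernel (semidirect N H \<sigma>) (M \<times>\<times> H) (map_prod p id)"
    unfolding ker by (auto simp: kernel_def)
  ultimately show ?thesis
    using gr H by (simp add: short_exact_def group_semidirect[OF gr(2) H \<sigma>] DirProd_group)
qed

text \<open>The automorphisms that preserve \<open>p\<close> form a subgroup, so it contains the
  negative powers of \<theta> as well. This supplies the invariance hypothesis of
  \<open>short_exact_semidirect\<close> for an action of the integers.\<close>

lemma invariant_int_pow_AutoGroup:
  assumes "group N" "\<theta> \<in> auto N" and inv: "\<And>x. x \<in> carrier N \<Longrightarrow> p (\<theta> x) = p x"
    and "x \<in> carrier N"
  shows "p ((\<theta> [^]\<^bsub>AutoGroup N\<^esub> (m :: int)) x) = p x"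
proof -
  interpret N: group N by fact
  interpret A: group "AutoGroup N" by (rule N.AutoGroup)
  let ?S = "{f \<in> auto N. \<forall>x\<in>carrier N. p (f x) = p x}"
  have "subgroup ?S (AutoGroup N)"
  proof (rule A.subgroupI)
    show "?S \<noteq> {}" using assms by blast
  next
    fix f assume f: "f \<in> ?S"
    let ?g = "inv\<^bsub>AutoGroup N\<^esub> f"
    have g: "?g \<in> auto N" using f A.inv_closed[of f] by (simp add: carrier_AutoGroup)
    have "p (?g x) = p x" if x: "x \<in> carrier N" for x
    proof -
      have "f \<otimes>\<^bsub>AutoGroup N\<^esub> ?g = \<one>\<^bsub>AutoGroup N\<^esub>"
        using f by (simp add: carrier_AutoGroup)
      then have "compose (carrier N) f ?g = (\<lambda>x\<in>carrier N. x)"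
        using f g by (simp add: mult_AutoGroup one_AutoGroup)
      from fun_cong[OF this, of x] have "f (?g x) = x"
        using x by (simp add: compose_eq)
      moreover have "p (f (?g x)) = p (?g x)" using f auto_closed[OF g x] by blast
      ultimately show ?thesis by simp
    qed
    with g show "?g \<in> ?S" by simp
  next
    fix f g assume fg: "f \<in> ?S" "g \<in> ?S"
    have "f \<otimes>\<^bsub>AutoGroup N\<^esub> g \<in> auto N"
      using fg A.m_closed[of f g] by (simp add: carrier_AutoGroup)
    with fg show "f \<otimes>\<^bsub>AutoGroup N\<^esub> g \<in> ?S"
      by (simp add: mult_AutoGroup compose_eq auto_closed)
  qed (auto simp: carrier_AutoGroup)
  moreover have "\<theta> \<in> ?S" using assms by simp
  ultimately have "\<theta> [^]\<^bsub>AutoGroup N\<^esub> m \<in> ?S"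
    by (rule A.subgroup_int_pow_closed)
  then show ?thesis using assms(4) by simp
qed

section \<open>Transfer to groups of natural numbers\<close>

lemma image_group_mult:
  assumes "inj_on f (carrier G)" "x \<in> carrier G" "y \<in> carrier G"
  shows "f x \<otimes>\<^bsub>image_group f G\<^esub> f y = f (x \<otimes>\<^bsub>G\<^esub> y)"
  using assms by (simp add: image_group_def)

text \<open>Transport of structure: on the image of \<open>f\<close> the map
  \<open>inv_into UNIV f\<close> undoes \<open>f\<close>, so the projection becomes \<open>q\<close>
  conjugated by the two injections.\<close>

lemma short_exact_image_group:
  assumes ex: "short_exact N \<iota> G' q G" and inj: "inj f" "inj g"
  shows "short_exact N (f \<circ> \<iota>) (image_group f G') (g \<circ> q \<circ> inv_into UNIV f) (image_group g G)"
proof -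
  from ex have gr: "group N" "group G'" "group G"
    and \<iota>: "\<iota> \<in> mon N G'" and q: "q \<in> epi G' G" and ker: "\<iota> ` carrier N = kernel G' G q"
    by (auto simp: short_exact_def)
  note inj_on = inj[THEN inj_on_subset, OF subset_UNIV]
  note mult = image_group_mult[OF inj_on(1)] image_group_mult[OF inj_on(2)]
  have "group (image_group f G')" "group (image_group g G)"
    using gr by (simp_all add: group.inj_imp_image_group_is_group inj_on)
  moreover have "f \<circ> \<iota> \<in> mon N (image_group f G')"
    using \<iota> inj by (auto simp: mon_def hom_def image_group_carrier mult Pi_iff inj_on_def)
  moreover have "g \<circ> q \<circ> inv_into UNIV f \<in> hom (image_group f G') (image_group g G)"
    using q inj group.is_monoid[OF gr(2)]
    by (auto simp: epi_def hom_def image_group_carrier mult Pi_iff)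
  moreover have "(g \<circ> q \<circ> inv_into UNIV f) ` f ` carrier G' = g ` q ` carrier G'"
    using inj(1) by (simp add: image_image)
  moreover have "q ` carrier G' = carrier G"
    using q by (simp add: epi_def)
  moreover have "(f \<circ> \<iota>) ` carrier N
      = kernel (image_group f G') (image_group g G) (g \<circ> q \<circ> inv_into UNIV f)"
    using inj unfolding image_comp[symmetric] ker
    by (auto simp: kernel_def image_group_carrier image_group_one inj_eq)
  ultimately show ?thesis
    using gr(1) by (simp add: short_exact_def epi_def image_group_carrier)
qed

lemma commuting_lifts_image_group:
  assumes "group G'" "inj f" "inj g"
  shows "commuting_lifts (image_group f G') (g \<alpha>) (g \<beta>) (g \<circ> q \<circ> inv_into UNIV f)
    = map_prod f f ` commuting_lifts G' \<alpha> \<beta> q"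
proof -
  interpret group G' by fact
  have mult: "f x \<otimes>\<^bsub>image_group f G'\<^esub> f y = f (x \<otimes>\<^bsub>G'\<^esub> y)"
    if "x \<in> carrier G'" "y \<in> carrier G'" for x y
    using that assms by (intro image_group_mult) (auto intro: inj_on_subset)
  show ?thesis
    using assms(2,3) unfolding commuting_lifts_def image_group_carrier
    by (auto simp: mult inj_eq image_iff)
qed

text \<open>HOL has no existential quantifier over types, so both groups are placed on
  \<open>nat\<close>.\<close>

definition lifts_number :: "nat \<Rightarrow> bool" where
  "lifts_number n \<longleftrightarrow> (\<exists>(G' :: nat monoid) (G :: nat monoid) \<iota> q \<alpha> \<beta>.
      short_exact Q8 \<iota> G' q G \<and>
      \<alpha> \<in> carrier G \<and> \<beta> \<in> carrier G \<and> \<alpha> \<otimes>\<^bsub>G\<^esub> \<beta> = \<beta> \<otimes>\<^bsub>G\<^esub> \<alpha> \<and>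
      finite (commuting_lifts G' \<alpha> \<beta> q) \<and> card (commuting_lifts G' \<alpha> \<beta> q) = n)"

text \<open>Countable types inject into \<open>nat\<close>, so witnesses may be built on any
  countable types and transported.\<close>

lemma lifts_numberI:
  fixes G' :: "'b::countable monoid" and G :: "'c::countable monoid"
  assumes ex: "short_exact Q8 \<iota> G' q G"
    and \<alpha>\<beta>: "\<alpha> \<in> carrier G" "\<beta> \<in> carrier G" "\<alpha> \<otimes>\<^bsub>G\<^esub> \<beta> = \<beta> \<otimes>\<^bsub>G\<^esub> \<alpha>"
    and fin: "finite (commuting_lifts G' \<alpha> \<beta> q)"
    and card: "card (commuting_lifts G' \<alpha> \<beta> q) = n"
  shows "lifts_number n"
proof -
  obtain f :: "'b \<Rightarrow> nat" where f: "inj f" by (rule that) (rule inj_to_nat)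
  obtain g :: "'c \<Rightarrow> nat" where g: "inj g" by (rule that) (rule inj_to_nat)
  have "group G'" "group G" using ex by (auto simp: short_exact_def)
  note lifts = commuting_lifts_image_group[OF \<open>group G'\<close> f g, of \<alpha> \<beta> q]
  have "card (map_prod f f ` commuting_lifts G' \<alpha> \<beta> q) = n"
    using card f by (subst card_image) (auto simp: inj_on_def)
  moreover have "g \<alpha> \<otimes>\<^bsub>image_group g G\<^esub> g \<beta> = g \<beta> \<otimes>\<^bsub>image_group g G\<^esub> g \<alpha>"
    using \<alpha>\<beta> inj_on_subset[OF g] by (simp add: image_group_mult)
  ultimately show ?thesis
    unfolding lifts_number_def
    using short_exact_image_group[OF ex f g] \<alpha>\<beta> fin lifts
    by (intro exI[of _ "image_group f G'"] exI[of _ "image_group g G"] exI[of _ "f \<circ> \<iota>"]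
        exI[of _ "g \<circ> q \<circ> inv_into UNIV f"] exI[of _ "g \<alpha>"] exI[of _ "g \<beta>"])
      (simp add: image_group_carrier)
qed

section \<open>Extensions of the free abelian group of rank two by the quaternion group\<close>

text \<open>Finite types are countable, so products of this one with \<open>int\<close> meet the
  sort constraint of \<open>lifts_numberI\<close>.\<close>

instance quat_unit :: finite
  by standard (simp add: UNIV_quat_unit)

lemma carrier_Q8 [simp]: "carrier Q8 = UNIV"
  and mult_Q8 [simp]: "x \<otimes>\<^bsub>Q8\<^esub> y = quat_mult x y"
  and one_Q8 [simp]: "\<one>\<^bsub>Q8\<^esub> = (False, U1)"
  by (simp_all add: Q8_def)

lemma quat_mult_sign:
  "quat_mult (s, U1) (t, u) = (s \<noteq> t, u)"
  "quat_mult (t, u) (s, U1) = (s \<noteq> t, u)"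
  by (cases u; auto)+

text \<open>The elements \<open>(s, U1)\<close> are the signs +1 and -1, which are central; this
  makes \<open>twist\<close> multiplicative.\<close>

lemma quat_mult_sign_mult:
  "quat_mult (quat_mult (s, U1) x) (quat_mult (t, U1) y) = quat_mult (s \<noteq> t, U1) (quat_mult x y)"
  by (cases x; cases y; cases "snd x"; cases "snd y") (auto simp: quat_mult_sign)

abbreviation QZ :: "((bool \<times> quat_unit) \<times> int) monoid" where
  "QZ \<equiv> Q8 \<times>\<times> integer_group"

lemma group_QZ: "group QZ"
  by (simp add: DirProd_group group_Q8)

lemma short_exact_QZ: "short_exact Q8 (\<lambda>x. (x, 0)) QZ snd integer_group"
  by (auto simp: short_exact_def group_Q8 group_QZ mon_def epi_def hom_def inj_on_def kernel_def
      quat_mult_sign)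

text \<open>Conjugation by \<open>a\<close>: the pair \<open>(x, t)\<close> stands for
  \<open>x b^t\<close>, and \<open>b^t\<close> goes to \<open>(-b)^t = (-1)^t b^t\<close> because -1
  is central.\<close>

definition twist ::
    "(bool \<times> quat_unit \<Rightarrow> bool \<times> quat_unit) \<Rightarrow> (bool \<times> quat_unit) \<times> int \<Rightarrow> (bool \<times> quat_unit) \<times> int"
  where "twist \<phi> = (\<lambda>(x, t). (quat_mult (odd t, U1) (\<phi> x), t))"

lemma twist_in_auto:
  assumes "\<phi> \<in> iso Q8 Q8"
  shows "twist \<phi> \<in> auto QZ"
proof -
  have \<phi>: "\<phi> (quat_mult x y) = quat_mult (\<phi> x) (\<phi> y)" "bij \<phi>" for x y
    using assms by (auto simp: iso_def hom_def split_paired_all simp del: quat_mult.simps split_paired_All)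
  have "odd (s + t) = (odd s \<noteq> odd t)" for s t :: int by auto
  then have "twist \<phi> \<in> hom QZ QZ"
    by (auto simp: hom_def twist_def \<phi>(1) quat_mult_sign_mult simp del: quat_mult.simps)
  moreover have "bij (twist \<phi>)"
  proof (rule o_bij)
    have *: "quat_mult (s, U1) (quat_mult (s, U1) y) = y" for s y
      by (cases y) (auto simp: quat_mult_sign)
    \<comment> \<open>Multiplying by the same sign again cancels it, after which \<phi> can be
      undone.\<close>
    let ?\<psi> = "\<lambda>(y, t). (inv_into UNIV \<phi> (quat_mult (odd t, U1) y), t)"
    show "?\<psi> \<circ> twist \<phi> = id" "twist \<phi> \<circ> ?\<psi> = id"
      using \<phi>(2) by (auto simp: fun_eq_iff twist_def * bij_is_inj bij_is_surj surj_f_inv_f)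
  qed
  ultimately show ?thesis
    by (simp add: auto_def Bij_def)
qed

text \<open>The lifts of \<open>(0, m)\<close> and \<open>(t, 0)\<close> are \<open>x a^m\<close>
  and \<open>y b^t\<close>. Moving \<open>a^m\<close> to the right past \<open>y b^t\<close>
  replaces \<open>y\<close> by \<open>g y\<close>, so the two lifts commute iff
  \<open>x (g y) = y x\<close>.\<close>

lemma lifts_number_twist:
  assumes \<phi>: "\<phi> \<in> iso Q8 Q8"
    and act: "\<And>y. (twist \<phi> [^]\<^bsub>AutoGroup QZ\<^esub> (m :: int)) (y, t) = (g y, t)"
  shows "lifts_number (card {(x, y). quat_mult x (g y) = quat_mult y x})"
proof -
  define \<sigma> where "\<sigma> = (\<lambda>m :: int. twist \<phi> [^]\<^bsub>AutoGroup QZ\<^esub> m)"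
  note twist = twist_in_auto[OF \<phi>]
  have \<sigma>: "\<sigma> \<in> hom integer_group (AutoGroup QZ)"
    using twist group.hom_integer_group_pow[OF group.AutoGroup[OF group_QZ]]
    by (simp add: \<sigma>_def carrier_AutoGroup)
  \<comment> \<open>The action keeps the exponent of \<open>b\<close>, hence the quotient by the
    quaternion group is a direct product of two copies of the integers.\<close>
  have inv: "snd (\<sigma> m z) = snd z" for m z
    using invariant_int_pow_AutoGroup[OF group_QZ twist, of snd z m]
    by (simp add: \<sigma>_def twist_def split: prod.splits)
  have \<sigma>0: "\<sigma> 0 z = z" for z
    using hom_AutoGroup_simps(2)[OF group_QZ group_integer_group \<sigma>, of z] by simp
  have \<sigma>m: "\<sigma> m (y, t) = (g y, t)" for y
    using act by (simp add: \<sigma>_def)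
  let ?S = "{(x, y). quat_mult x (g y) = quat_mult y x}"
  let ?lifts = "commuting_lifts (semidirect QZ integer_group \<sigma>) (0, m) (t, 0) (map_prod snd id)"
  let ?F = "\<lambda>(x, y). (((x, 0 :: int), m), ((y, t), 0 :: int))"
  have lifts: "?lifts = ?F ` ?S"
    by (auto simp: commuting_lifts_def \<sigma>0 \<sigma>m image_iff)
  show ?thesis
  proof (rule lifts_numberI)
    show "short_exact Q8 (\<lambda>x. ((x, 0), \<one>\<^bsub>integer_group\<^esub>)) (semidirect QZ integer_group \<sigma>)
        (map_prod snd id) (integer_group \<times>\<times> integer_group)"
      using short_exact_semidirect[OF short_exact_QZ group_integer_group \<sigma>] inv by blast
    show "finite ?lifts" "card ?lifts = card ?S"
      unfolding lifts by (auto intro!: card_image inj_onI)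
  qed auto
qed

section \<open>Outer automorphisms of the quaternion group and the number of solutions\<close>

fun cycle_unit :: "quat_unit \<Rightarrow> quat_unit" where
  "cycle_unit U1 = U1" | "cycle_unit UI = UJ" | "cycle_unit UJ = UK" | "cycle_unit UK = UI"

fun cycle :: "bool \<times> quat_unit \<Rightarrow> bool \<times> quat_unit" where
  "cycle (s, u) = (s, cycle_unit u)"

text \<open>Exchanging i and j forces the sign on k, since ij = k and ji = -k.\<close>

fun swap :: "bool \<times> quat_unit \<Rightarrow> bool \<times> quat_unit" where
  "swap (s, U1) = (s, U1)"
| "swap (s, UI) = (s, UJ)"
| "swap (s, UJ) = (s, UI)"
| "swap (s, UK) = (\<not> s, UK)"

lemma cycle_iso: "cycle \<in> iso Q8 Q8"
proof -
  have "cycle (quat_mult x y) = quat_mult (cycle x) (cycle y)" for x y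
    by (cases x; cases y; cases "snd x"; cases "snd y") auto
  \<comment> \<open>The square of \<open>cycle\<close> serves as its inverse.\<close>
  moreover have "cycle \<circ> (cycle \<circ> cycle) = id"
  proof
    show "(cycle \<circ> (cycle \<circ> cycle)) x = id x" for x by (cases x; cases "snd x") auto
  qed
  then have "bij cycle" by (intro o_bij) (auto simp: comp_assoc)
  ultimately show ?thesis by (auto simp: iso_def hom_def)
qed

lemma swap_iso: "swap \<in> iso Q8 Q8"
proof -
  have "swap (quat_mult x y) = quat_mult (swap x) (swap y)" for x y
    by (cases x; cases y; cases "snd x"; cases "snd y") auto
  moreover have "swap \<circ> swap = id"
  proof
    show "(swap \<circ> swap) x = id x" for x by (cases x; cases "snd x") auto
  qed
  then have "bij swap" by (intro o_bij)
  ultimately show ?thesis by (auto simp: iso_def hom_def)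
qed

lemma sum_quat:
  "(\<Sum>x\<in>UNIV. f x) =
    f (False, U1) + f (False, UI) + f (False, UJ) + f (False, UK) +
    f (True, U1) + f (True, UI) + f (True, UJ) + (f (True, UK) :: nat)"
  by (simp add: UNIV_bool UNIV_quat_unit sum.cartesian_product'
      flip: UNIV_Times_UNIV)

text \<open>A sum of 64 indicators, which \<open>sum_quat\<close> expands for direct
  evaluation.\<close>

lemma card_solutions:
  "card {(x, y). quat_mult x (g y) = quat_mult y x} =
    (\<Sum>x\<in>UNIV. \<Sum>y\<in>UNIV. of_bool (quat_mult x (g y) = quat_mult y x))"
proof -
  have "{(x, y). quat_mult x (g y) = quat_mult y x} =
      (SIGMA x:UNIV. {y. quat_mult x (g y) = quat_mult y x})"
    by auto
  then show ?thesis by (simp add: sum.If_cases of_bool_def del: quat_mult.simps)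
qed

text \<open>Checked by evaluation, but explained by the quotient by the signs being abelian: the
  automorphism must fix y up to sign. For \<open>swap\<close> this leaves y = 1, -1, k, -k, and for
  \<open>cycle\<close> only y = 1, -1. Without the extra sign each y = 1, -1 admits all 8 values of
  x; with it, none. For y = k, -k there are 4 values of x in either case. The value 40 is 8 times
  the 5 conjugacy classes.\<close>

lemma card_solutions_values:
  "card {(x, y). quat_mult x y = quat_mult y x} = 40"
  "card {(x, y). quat_mult x (swap y) = quat_mult y x} = 24"
  "card {(x, y). quat_mult x (quat_mult (True, U1) (swap y)) = quat_mult y x} = 8"
  "card {(x, y). quat_mult x (cycle y) = quat_mult y x} = 16"
  "card {(x, y). quat_mult x (quat_mult (True, U1) (cycle y)) = quat_mult y x} = 0"
  unfolding card_solutions card_solutions[of "\<lambda>y. y"] sum_quat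
  by simp_all

lemma lifts_number_iso:
  assumes "\<phi> \<in> iso Q8 Q8"
  shows "lifts_number (card {(x, y). quat_mult x (\<phi> y) = quat_mult y x})"
    and "lifts_number (card {(x, y). quat_mult x (quat_mult (True, U1) (\<phi> y)) = quat_mult y x})"
proof -
  interpret A: group "AutoGroup QZ" by (rule group.AutoGroup[OF group_QZ])
  have pow: "twist \<phi> [^]\<^bsub>AutoGroup QZ\<^esub> (1 :: int) = twist \<phi>"
    using twist_in_auto[OF assms] by (simp add: carrier_AutoGroup)
  \<comment> \<open>For \<open>t = 0\<close> the sign inserted by \<open>twist\<close> is +1 and
    disappears; for \<open>t = 1\<close> it is -1 and stays in the equation.\<close>
  have "quat_mult (False, U1) y = y" for y by (cases y) simp
  then show "lifts_number (card {(x, y). quat_mult x (\<phi> y) = quat_mult y x})"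
    by (intro lifts_number_twist[OF assms, of 1 0]) (simp only: pow, simp add: twist_def)
  show "lifts_number (card {(x, y). quat_mult x (quat_mult (True, U1) (\<phi> y)) = quat_mult y x})"
    by (rule lifts_number_twist[OF assms, of 1 1]) (simp only: pow, simp add: twist_def)
qed

theorem theorem3:
  shows "\<forall>n \<in> {0, 8, 16, 24, 40 :: nat}.
    \<exists>(G' :: nat monoid) (G :: nat monoid) \<iota> q \<alpha> \<beta>.
      short_exact Q8 \<iota> G' q G \<and>
      \<alpha> \<in> carrier G \<and> \<beta> \<in> carrier G \<and> \<alpha> \<otimes>\<^bsub>G\<^esub> \<beta> = \<beta> \<otimes>\<^bsub>G\<^esub> \<alpha> \<and>
      finite (commuting_lifts G' \<alpha> \<beta> q) \<and> card (commuting_lifts G' \<alpha> \<beta> q) = n"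
proof -
  \<comment> \<open>The identity automorphism with \<open>t = 0\<close> counts the commuting pairs
    of the quaternion group.\<close>
  have "lifts_number 40"
    using lifts_number_iso(1)[OF iso_set_refl] by (simp add: card_solutions_values)
  \<comment> \<open>Each of the two outer automorphisms yields two values, for \<open>t = 0\<close>
    and \<open>t = 1\<close> in this order.\<close>
  moreover have "lifts_number 24" "lifts_number 8"
    using lifts_number_iso[OF swap_iso] by (simp_all only: card_solutions_values)
  moreover have "lifts_number 16" "lifts_number 0"
    using lifts_number_iso[OF cycle_iso] by (simp_all only: card_solutions_values)
  ultimately show ?thesis
    unfolding lifts_number_def[symmetric] by blast
qed

end
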